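(* For all integers $r\ge 3$ and $s\ge 2$ there exists $n(r,s)$ such that for every integer $n>n(r,s)$, $$m_0(s,\underbrace{n,\dots,n}_{r})=sn^{r-1}-(n-1)^{r-1}+n-s.$$
   Context: For integers $n_1\ge\dots\ge n_r$, let $X_\ell=[n_\ell]$. An $r$-partite $r$-graph is a family $\mathcal F\subseteq X_1\times\dots\times X_r$; its vertices are the pairs $(\ell,x)$ with $x\in X_\ell$, and an edge $A=(a_1,\dots,a_r)$ contains the vertex $(\ell,x)$ iff $a_\ell=x$. Two edges $A,B$ are disjoint if $A[\ell]\ne B[\ell]$ for all $\ell$. The matching number $\nu(\mathcal F)$ is the maximum number of pairwise disjoint edges of $\mathcal F$. A transversal is a set $T$ of vertices such that every edge of $\mathcal F$ contains a vertex of $T$; $\tau(\mathcal F)$ is the minimum size of a transversal. For integers $r\ge 3$ and $n_1\ge\dots\ge n_r>s\ge 1$, $m_0(s,n_1,\dots,n_r)$ denotes the maximum of $|\mathcal F|$ over all $\mathcal F\subseteq X_1\times\dots\times X_r$ with $\nu(\mathcal F)\le s<\tau(\mathcal F)$. *)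

theory Defs
  imports Main
begin

text \<open>Ground sets: X_l = {1..n_l} for l < r, where ns = [n_1,...,n_r] (0-indexed).
  An edge is a list A of length r with A ! l \<in> X_l. A family is a set of edges.\<close>

definition edges :: "nat list \<Rightarrow> nat list set" where
  "edges ns = {A. length A = length ns \<and> (\<forall>l < length ns. A ! l \<in> {1..ns ! l})}"

definition vertices :: "nat list \<Rightarrow> (nat \<times> nat) set" where
  "vertices ns = {(l, x). l < length ns \<and> x \<in> {1..ns ! l}}"

definition contains_vertex :: "nat list \<Rightarrow> nat \<times> nat \<Rightarrow> bool" where
  "contains_vertex A v = (fst v < length A \<and> A ! fst v = snd v)"

definition disjoint_edges :: "nat list \<Rightarrow> nat list \<Rightarrow> bool" where
  "disjoint_edges A B = (\<forall>l < length A. A ! l \<noteq> B ! l)"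

definition is_matching :: "nat list set \<Rightarrow> nat list set \<Rightarrow> bool" where
  "is_matching F M = (M \<subseteq> F \<and> (\<forall>A\<in>M. \<forall>B\<in>M. A \<noteq> B \<longrightarrow> disjoint_edges A B))"

definition matching_number :: "nat list set \<Rightarrow> nat" where
  "matching_number F = Max {card M | M. is_matching F M \<and> finite M}"

definition is_transversal :: "nat list \<Rightarrow> nat list set \<Rightarrow> (nat \<times> nat) set \<Rightarrow> bool" where
  "is_transversal ns F T = (T \<subseteq> vertices ns \<and> (\<forall>A\<in>F. \<exists>v\<in>T. contains_vertex A v))"

definition transversal_number :: "nat list \<Rightarrow> nat list set \<Rightarrow> nat" where
  "transversal_number ns F = Min {card T | T. is_transversal ns F T}"

definition m0 :: "nat \<Rightarrow> nat list \<Rightarrow> nat" where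
  "m0 s ns = Max {card F | F. F \<subseteq> edges ns \<and> matching_number F \<le> s
                                \<and> s < transversal_number ns F}"

end

theory Submission
  imports Defs
begin

text \<open>
  Upper bound. Call a vertex big if its degree exceeds \<open>r (s + 1) n\<^bsup>r-2\<^esup>\<close>. Greedily, a matching
  avoiding some big vertices extends by one edge through each of them, so \<open>\<nu> \<le> s < \<tau>\<close> leaves at most
  \<open>s - 1\<close> big vertices. With fewer than \<open>s - 1\<close> of them the family has only
  \<open>(s - 2) n\<^bsup>r-1\<^esup> + O(n\<^bsup>r-2\<^esup>)\<close> edges. With exactly \<open>s - 1\<close>, the edges avoiding them form an
  intersecting family without a common vertex, and a Hilton-Milner bound applies to it.

  For that bound, call a pair of vertices heavy if it lies in more than \<open>r n\<^bsup>r-3\<^esup>\<close> edges. Heavy pairs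
  meet every edge and each other, so they form a star or a triangle. All edges but
  \<open>O(n\<^bsup>r-3\<^esup>)\<close> contain one of the heavy pairs; at most \<open>r - 2\<close> heavy pairs are too few, and a star with
  \<open>r - 1\<close> leaves or a triangle determines the family up to inclusion.

  Lower bound. All edges through \<open>s - 1\<close> vertices of the first part, together with a Hilton-Milner
  family on the remaining vertices.
\<close>

section \<open>Counting edges\<close>

text \<open>Arbitrary side sets let pinned, punctured and restricted coordinates all be counted by
  one product formula.\<close>

definition box :: "nat \<Rightarrow> (nat \<Rightarrow> nat set) \<Rightarrow> nat list set" where
  "box r Y = {A. length A = r \<and> (\<forall>l<r. A ! l \<in> Y l)}"

definition cube :: "nat \<Rightarrow> nat \<Rightarrow> nat list set" where
  "cube r n = box r (\<lambda>_. {1..n})"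

text \<open>Treating an edge as a set of vertices turns disjointness, matchings and transversals
  into statements about intersections.\<close>

definition vset :: "nat list \<Rightarrow> (nat \<times> nat) set" where
  "vset A = (\<lambda>l. (l, A ! l)) ` {..<length A}"

lemma edges_replicate: "edges (replicate r n) = cube r n"
  by (auto simp: edges_def cube_def box_def)

lemma box_mono: "(\<And>l. l < r \<Longrightarrow> Y l \<subseteq> Z l) \<Longrightarrow> box r Y \<subseteq> box r Z"
  by (auto simp: box_def)

lemma box_Suc: "box (Suc r) Y = (\<lambda>(A, x). A @ [x]) ` (box r Y \<times> Y r)"
proof (intro equalityI subsetI)
  fix A assume A: "A \<in> box (Suc r) Y"
  then have "A \<noteq> []" "length A = Suc r" by (auto simp: box_def)
  then obtain B x where "A = B @ [x]" by (metis append_butlast_last_id)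
  moreover from this A have "length B = r" and "\<And>l. l < Suc r \<Longrightarrow> (B @ [x]) ! l \<in> Y l"
    by (auto simp: box_def)
  moreover from this(2)[of r] this(1) have "x \<in> Y r" by (simp add: nth_append)
  moreover have "B ! l \<in> Y l" if "l < r" for l
    using calculation(2) calculation(3)[of l] that by (simp add: nth_append)
  ultimately show "A \<in> (\<lambda>(A, x). A @ [x]) ` (box r Y \<times> Y r)"
    by (auto simp: box_def)
qed (auto simp: box_def nth_append less_Suc_eq)

lemma card_box: "card (box r Y) = (\<Prod>l<r. card (Y l))"
proof (induction r)
  case 0
  have "box 0 Y = {[]}" by (auto simp: box_def)
  then show ?case by simp
next
  case (Suc r)
  have "inj_on (\<lambda>(A, x). A @ [x]) (box r Y \<times> Y r)"
    by (auto simp: inj_on_def)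
  then have "card (box (Suc r) Y) = card (box r Y) * card (Y r)"
    unfolding box_Suc by (simp add: card_image card_cartesian_product)
  then show ?case using Suc by simp
qed

lemma finite_box: "(\<And>l. l < r \<Longrightarrow> finite (Y l)) \<Longrightarrow> finite (box r Y)"
proof (induction r)
  case 0
  have "box 0 Y = {[]}" by (auto simp: box_def)
  then show ?case by simp
next
  case (Suc r)
  then show ?case unfolding box_Suc by simp
qed

lemma finite_cube [simp]: "finite (cube r n)"
  by (simp add: cube_def finite_box)

lemma finite_vset [simp]: "finite (vset A)"
  by (simp add: vset_def)

lemma mem_vset: "(l, x) \<in> vset A \<longleftrightarrow> l < length A \<and> A ! l = x"
  by (auto simp: vset_def)

lemma card_vset: "card (vset A) = length A"
  by (simp add: vset_def card_image inj_on_def)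

lemma inj_on_fst_vset: "inj_on fst (vset A)"
  by (auto simp: inj_on_def vset_def)

lemma disjoint_edges_iff:
  "length A = length B \<Longrightarrow> disjoint_edges A B \<longleftrightarrow> vset A \<inter> vset B = {}"
  by (fastforce simp: disjoint_edges_def vset_def)

lemma contains_vertex_iff: "contains_vertex A v \<longleftrightarrow> v \<in> vset A"
  by (cases v) (auto simp: contains_vertex_def mem_vset)

lemma prod_if_mem:
  fixes c :: "nat \<Rightarrow> nat"
  assumes "D \<subseteq> {..<r}"
  shows "(\<Prod>l<r. if l \<in> D then 1 else c l) = (\<Prod>l\<in>{..<r} - D. c l)"
proof -
  have "{..<r} \<inter> - D = {..<r} - D" by auto
  then show ?thesis by (simp add: prod.If_cases)
qed

text \<open>The edges through \<open>S\<close> form a box with \<open>card S\<close> pinned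
  coordinates. The witness \<open>A\<close> guarantees that \<open>S\<close> has at most one vertex
  in each part, all in range; otherwise no edge contains \<open>S\<close>.\<close>

lemma card_edges_containing:
  assumes "A \<in> cube r n" "S \<subseteq> vset A"
  shows "card {B \<in> cube r n. S \<subseteq> vset B} = n ^ (r - card S)"
proof -
  let ?D = "fst ` S"
  let ?Y = "\<lambda>l. if l \<in> ?D then {A ! l} else {1..n}"
  have r: "length A = r" using assms by (simp add: cube_def box_def)
  have D: "?D \<subseteq> {..<r}" using assms r by (auto simp: vset_def)
  have cD: "card ?D = card S"
    by (metis card_image inj_on_fst_vset inj_on_subset assms(2))
  have "{B \<in> cube r n. S \<subseteq> vset B} = box r ?Y"
  proof (intro equalityI subsetI)
    fix B assume B: "B \<in> {B \<in> cube r n. S \<subseteq> vset B}"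
    have "B ! l = A ! l" if "(l, x) \<in> S" for l x
    proof -
      have "(l, x) \<in> vset B" "(l, x) \<in> vset A" using that B assms by auto
      then show ?thesis by (simp add: mem_vset)
    qed
    then show "B \<in> box r ?Y" using B by (auto simp: cube_def box_def)
  next
    fix B assume B: "B \<in> box r ?Y"
    then have lB: "length B = r" by (simp add: box_def)
    have "B \<in> cube r n" using B assms(1) by (fastforce simp: cube_def box_def split: if_splits)
    moreover have "(l, x) \<in> vset B" if lx: "(l, x) \<in> S" for l x
    proof -
      have "l \<in> ?D" using lx by force
      moreover have "(l, x) \<in> vset A" using lx assms by auto
      moreover have "l < r" "A ! l = x" using calculation r by (auto simp: mem_vset)
      moreover have "B ! l \<in> ?Y l" using B \<open>l < r\<close> unfolding box_def by blast
      ultimately have "l < r" "A ! l = x" "B ! l = A ! l" by auto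
      then show ?thesis using lB by (simp add: mem_vset)
    qed
    ultimately show "B \<in> {B \<in> cube r n. S \<subseteq> vset B}" by auto
  qed
  then have "card {B \<in> cube r n. S \<subseteq> vset B} = (\<Prod>l<r. if l \<in> ?D then 1 else n)"
    by (simp add: card_box if_distrib cong: if_cong)
  also have "\<dots> = n ^ card ({..<r} - ?D)"
    using prod_if_mem[OF D, of "\<lambda>_. n"] by simp
  also have "card ({..<r} - ?D) = r - card S"
    using card_Diff_subset[OF finite_subset[OF D] D] cD by simp
  finally show ?thesis .
qed

lemma card_edges_containing_le: "card {B \<in> cube r n. S \<subseteq> vset B} \<le> n ^ (r - card S)"
proof (cases "{B \<in> cube r n. S \<subseteq> vset B} = {}")
  case False
  then obtain A where "A \<in> cube r n" "S \<subseteq> vset A" by blast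
  then show ?thesis using card_edges_containing by simp
qed (simp only: card.empty)

text \<open>Union bound: disjointness makes each \<open>w\<close> a further pinned vertex, which
  costs a factor \<open>n\<close>. So many edges through \<open>S\<close> cannot all meet a small
  set off \<open>S\<close>; both heavy pairs and big vertices rest on this.\<close>

lemma card_edges_meeting_le:
  assumes "finite W" "finite S" "W \<inter> S = {}"
  shows "card {B \<in> cube r n. S \<subseteq> vset B \<and> vset B \<inter> W \<noteq> {}} \<le> card W * n ^ (r - 1 - card S)"
proof -
  have "{B \<in> cube r n. S \<subseteq> vset B \<and> vset B \<inter> W \<noteq> {}}
      \<subseteq> (\<Union>w\<in>W. {B \<in> cube r n. insert w S \<subseteq> vset B})" by blast
  then have "card {B \<in> cube r n. S \<subseteq> vset B \<and> vset B \<inter> W \<noteq> {}}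
      \<le> card (\<Union>w\<in>W. {B \<in> cube r n. insert w S \<subseteq> vset B})"
    using assms(1) by (intro card_mono) auto
  also have "\<dots> \<le> (\<Sum>w\<in>W. card {B \<in> cube r n. insert w S \<subseteq> vset B})"
    using assms(1) by (rule card_UN_le)
  also have "\<dots> \<le> (\<Sum>w\<in>W. n ^ (r - 1 - card S))"
  proof (rule sum_mono)
    fix w assume "w \<in> W"
    then have "card (insert w S) = Suc (card S)" using assms by (metis card_insert_disjoint disjoint_iff)
    then show "card {B \<in> cube r n. insert w S \<subseteq> vset B} \<le> n ^ (r - 1 - card S)"
      using card_edges_containing_le[of r n "insert w S"] by simp
  qed
  finally show ?thesis by simp
qed

section \<open>The Hilton-Milner bound\<close>

lemma Suc_power_ge: "k ^ Suc q + Suc q * k ^ q \<le> Suc k ^ Suc q" for k :: nat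
proof (induction q)
  case (Suc q)
  have "k ^ Suc (Suc q) + Suc (Suc q) * k ^ Suc q = k * (k ^ Suc q + Suc q * k ^ q) + k ^ Suc q"
    by (simp add: algebra_simps)
  also have "\<dots> \<le> k * Suc k ^ Suc q + Suc k ^ Suc q"
    using Suc by (intro add_mono mult_left_mono power_mono) auto
  finally show ?case by simp
qed simp

lemma Suc_power_le: "Suc k ^ Suc q \<le> k ^ Suc q + Suc q * Suc k ^ q" for k :: nat
proof (induction q)
  case (Suc q)
  have "Suc k ^ Suc (Suc q) = k * Suc k ^ Suc q + Suc k ^ Suc q" by simp
  also have "\<dots> \<le> k * (k ^ Suc q + Suc q * Suc k ^ q) + Suc k ^ Suc q"
    using Suc by simp
  also have "\<dots> \<le> k ^ Suc (Suc q) + Suc q * Suc k ^ Suc q + Suc k ^ Suc q"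
    by (simp add: algebra_simps)
  finally show ?case by simp
qed simp

text \<open>To leading order \<open>Suc k ^ (q + 2) - k ^ (q + 2)\<close> is \<open>q + 2\<close>
  times \<open>Suc k ^ (q + 1)\<close>, one term more than \<open>q + 1\<close> pairs contribute.
  The spare term absorbs the \<open>C\<close> summand and the error from replacing
  \<open>k ^ (q + 1)\<close> by \<open>Suc k ^ (q + 1)\<close>.\<close>

lemma few_heavy_pairs_estimate:
  fixes k q C :: nat
  assumes "C + (q + 2) * (q + 1) \<le> Suc k"
  shows "(q + 1) * Suc k ^ (q + 1) + C * Suc k ^ q + k ^ (q + 2) \<le> Suc k ^ (q + 2)"
proof -
  have 1: "k ^ (q + 2) + (q + 2) * k ^ (q + 1) \<le> Suc k ^ (q + 2)"
    using Suc_power_ge[of k "q + 1"] by simp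
  have "(q + 2) * Suc k ^ (q + 1) \<le> (q + 2) * (k ^ (q + 1) + (q + 1) * Suc k ^ q)"
    using Suc_power_le[of k q] by (intro mult_left_mono) auto
  then have 2: "(q + 1) * Suc k ^ (q + 1) + Suc k ^ (q + 1)
      \<le> (q + 2) * k ^ (q + 1) + (q + 2) * (q + 1) * Suc k ^ q"
    by (simp add: algebra_simps)
  have "(C + (q + 2) * (q + 1)) * Suc k ^ q \<le> Suc k * Suc k ^ q"
    using assms by (rule mult_right_mono) simp
  then have 3: "C * Suc k ^ q + (q + 2) * (q + 1) * Suc k ^ q \<le> Suc k ^ (q + 1)"
    by (simp only: add_mult_distrib power_Suc Suc_eq_plus1[symmetric])
  show ?thesis using 1 2 3 by linarith
qed

text \<open>Equality holds at \<open>q = 0\<close>, so for \<open>r = 3\<close> the triangle bound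
  is tight against the target. In the induction step, multiplying by \<open>Suc k\<close> creates a
  surplus \<open>k ^ (q + 2) + k\<close> on the left, which outweighs the extra \<open>m * k\<close>
  on the right.\<close>

lemma triangle_estimate:
  fixes k q m :: nat
  assumes "m \<le> Suc k"
  shows "(m + 2 * k) * Suc k ^ q + k ^ (q + 2) + 1 \<le> Suc k ^ (q + 2) + m"
proof (induction q)
  case 0
  then show ?case by (simp add: power2_eq_square)
next
  case (Suc q)
  have "m * k \<le> Suc k * k" using assms by (rule mult_right_mono) simp
  also have "Suc k * k \<le> k ^ (q + 2) + k"
    using power_increasing[of 2 "q + 2" k] by (cases "k = 0") (simp_all add: power2_eq_square)
  finally have 1: "m * k \<le> k ^ (q + 2) + k" .
  have "Suc k * ((m + 2 * k) * Suc k ^ q + k ^ (q + 2) + 1) \<le> Suc k * (Suc k ^ (q + 2) + m)"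
    using Suc by (rule mult_left_mono) simp
  then have "(m + 2 * k) * Suc k ^ Suc q + k ^ (Suc q + 2) + k ^ (q + 2) + k + 1
      \<le> Suc k ^ (Suc q + 2) + m + m * k"
    by (simp add: algebra_simps)
  then show ?case using 1 by linarith
qed

text \<open>Serves a star centred outside the restricted part, with \<open>card M = Suc m\<close>
  and \<open>d\<close> missing values. After cancellation only
  \<open>d * (k ^ (q + 1) + 1) \<le> d * Suc k ^ (q + 1)\<close> remains.\<close>

lemma star_estimate:
  fixes k q m d :: nat
  assumes "k = m + d"
  shows "Suc m * Suc k ^ (q + 1) + k + k ^ (q + 2) + 1 \<le> Suc k ^ (q + 2) + Suc m + m * k ^ (q + 1)"
proof -
  have "k ^ (q + 1) + 1 \<le> Suc k ^ (q + 1)"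
    using power_strict_mono[of k "Suc k" "q + 1"] by simp
  then have "d * (k ^ (q + 1) + 1) \<le> d * Suc k ^ (q + 1)" by (rule mult_left_mono) simp
  moreover have "k ^ (q + 2) = m * k ^ (q + 1) + d * k ^ (q + 1)"
    using assms by (simp add: algebra_simps)
  moreover have "Suc k ^ (q + 2) = Suc m * Suc k ^ (q + 1) + d * Suc k ^ (q + 1)"
    using assms by (simp add: algebra_simps)
  moreover have "d * (k ^ (q + 1) + 1) = d * k ^ (q + 1) + d" by (simp add: algebra_simps)
  ultimately show ?thesis using assms by linarith
qed

section \<open>Box counts for a star and for a triangle of heavy pairs\<close>

lemma prod_one_exception:
  fixes a b :: nat
  assumes "finite I"
  shows "(\<Prod>l\<in>I. if l = j then a else b) = (if j \<in> I then a * b ^ (card I - 1) else b ^ card I)"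
proof (cases "j \<in> I")
  case True
  have "(\<Prod>l\<in>I - {j}. if l = j then a else b) = (\<Prod>l\<in>I - {j}. b)"
    by (rule prod.cong) auto
  then show ?thesis using True assms
    by (simp add: prod.remove[OF assms True] card_Diff_singleton)
next
  case False
  then have "(\<Prod>l\<in>I. if l = j then a else b) = (\<Prod>l\<in>I. b)"
    by (intro prod.cong) auto
  then show ?thesis using False by simp
qed

lemma card_box_upd1:
  assumes "p < r"
  shows "card (box r (Y(p := Z))) = card Z * (\<Prod>l\<in>{..<r} - {p}. card (Y l))"
proof -
  have "(\<Prod>l\<in>{..<r} - {p}. card ((Y(p := Z)) l)) = (\<Prod>l\<in>{..<r} - {p}. card (Y l))"
    by (rule prod.cong) auto
  then show ?thesis using assms unfolding card_box
    by (subst prod.remove[of _ p]) auto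
qed

lemma card_box_upd3:
  assumes "a < r" "b < r" "c < r" "a \<noteq> b" "a \<noteq> c" "b \<noteq> c"
  shows "card (box r (Y(a := Z1, b := Z2, c := Z3)))
    = card Z1 * card Z2 * card Z3 * (\<Prod>l\<in>{..<r} - {a, b, c}. card (Y l))"
proof -
  let ?Y = "Y(a := Z1, b := Z2, c := Z3)"
  have "(\<Prod>l<r. card (?Y l)) = (\<Prod>l\<in>{..<r} - {a, b, c}. card (?Y l)) * (\<Prod>l\<in>{a, b, c}. card (?Y l))"
    by (rule prod.subset_diff) (use assms in auto)
  also have "(\<Prod>l\<in>{..<r} - {a, b, c}. card (?Y l)) = (\<Prod>l\<in>{..<r} - {a, b, c}. card (Y l))"
    by (rule prod.cong) auto
  also have "(\<Prod>l\<in>{a, b, c}. card (?Y l)) = card Z1 * card Z2 * card Z3"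
    using assms by simp
  finally show ?thesis unfolding card_box by (simp only: mult.commute)
qed

text \<open>This is the Hilton-Milner configuration with centre \<open>(p, x)\<close>: edges through
  the centre must meet \<open>B\<close> outside part \<open>p\<close>, and the others can differ
  from \<open>B\<close> only in part \<open>p\<close>. The former lie in \<open>X1 - X2\<close>, the
  latter in \<open>X3\<close>.\<close>

lemma star_case:
  assumes r: "r = q + 3" and n: "n = Suc k" and j: "j < r" and p: "p < r"
    and M: "M \<subseteq> {1..n}" and F: "F \<subseteq> cube r n" "\<And>A. A \<in> F \<Longrightarrow> A ! j \<in> M"
    and B: "B \<in> F" and A0: "A0 \<in> F" "A0 ! p = x"
    and hit: "\<And>A. A \<in> F \<Longrightarrow> A ! p = x \<Longrightarrow> \<exists>l<r. l \<noteq> p \<and> A ! l = B ! l"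
    and out: "\<And>A l. A \<in> F \<Longrightarrow> A ! p \<noteq> x \<Longrightarrow> l < r \<Longrightarrow> l \<noteq> p \<Longrightarrow> A ! l = B ! l"
  shows "card F + k ^ (q + 2) + 1 \<le> n ^ (q + 2) + card M"
proof -
  define R where "R = (\<lambda>l. if l = j then M else {1..n})"
  define X1 where "X1 = box r (R(p := {x}))"
  define X2 where "X2 = box r ((\<lambda>l. R l - {B ! l})(p := {x}))"
  define X3 where "X3 = box r ((\<lambda>l. {B ! l})(p := R p - {x}))"
  have FR: "A ! l \<in> R l" if "A \<in> F" "l < r" for A l
    using F that by (auto simp: R_def cube_def box_def)
  have len: "length A = r" if "A \<in> F" for A
    using F that by (auto simp: cube_def box_def)
  have finM: "finite M" using M by (rule finite_subset) simp
  have finR: "finite (R l)" for l using finM by (simp add: R_def)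
  have cR: "card (R l) = (if l = j then card M else n)" for l by (simp add: R_def)
  have cM: "1 \<le> card M" "card M \<le> n"
    using F(2)[OF B] finM card_mono[OF _ M] by (auto simp: card_gt_0_iff Suc_le_eq)
  have fin: "finite X1" "finite X2" "finite X3"
    unfolding X1_def X2_def X3_def using finR by (auto intro!: finite_box)
  have X21: "X2 \<subseteq> X1" unfolding X1_def X2_def by (rule box_mono) auto
  have "F \<subseteq> (X1 - X2) \<union> X3"
  proof
    fix A assume A: "A \<in> F"
    show "A \<in> (X1 - X2) \<union> X3"
    proof (cases "A ! p = x")
      case True
      have "A \<in> X1" using True A FR len by (auto simp: X1_def box_def)
      moreover have "A \<notin> X2"
      proof
        assume "A \<in> X2"
        obtain l where l: "l < r" "l \<noteq> p" "A ! l = B ! l" using hit[OF A True] by blast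
        have "A ! l \<in> ((\<lambda>l. R l - {B ! l})(p := {x})) l"
          using \<open>A \<in> X2\<close> l(1) unfolding X2_def box_def by blast
        then show False using l by simp
      qed
      ultimately show ?thesis by blast
    next
      case False
      then have "A \<in> X3" using A FR[OF A p] len out[OF A False] by (auto simp: X3_def box_def)
      then show ?thesis by blast
    qed
  qed
  then have "card F \<le> card ((X1 - X2) \<union> X3)" using fin by (intro card_mono) auto
  also have "\<dots> \<le> card (X1 - X2) + card X3" by (rule card_Un_le)
  also have "card (X1 - X2) = card X1 - card X2" using X21 fin by (simp add: card_Diff_subset)
  finally have cF: "card F + card X2 \<le> card X1 + card X3"
    using card_mono[OF fin(1) X21] by linarith
  have cX1: "card X1 = (\<Prod>l\<in>{..<r} - {p}. if l = j then card M else n)"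
    unfolding X1_def card_box_upd1[OF p] by (simp add: cR)
  have cR': "card (R l - {B ! l}) = (if l = j then card M - 1 else k)" if "l < r" for l
    using FR[OF B that] n by (simp add: card_Diff_singleton cR)
  have cX2: "card X2 = (\<Prod>l\<in>{..<r} - {p}. if l = j then card M - 1 else k)"
    unfolding X2_def card_box_upd1[OF p] using cR' by (auto intro!: prod.cong)
  have "card X3 = card (R p - {x})"
    unfolding X3_def card_box_upd1[OF p] by simp
  \<comment> \<open>\<open>A0\<close> puts \<open>x\<close> into \<open>R p\<close>, so removing it
    really lowers the count by one.\<close>
  then have cX3: "card X3 = card (R p) - 1"
    using FR[OF A0(1) p] A0(2) by (simp add: card_Diff_singleton)
  have cI: "card ({..<r} - {p}) = q + 2" using p r by (simp add: card_Diff_singleton)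
  \<comment> \<open>With the centre in the restricted part, \<open>M\<close> shrinks only
    \<open>X3\<close>; otherwise it shrinks \<open>X1\<close> and \<open>X2\<close> instead.\<close>
  show ?thesis
  proof (cases "p = j")
    case True
    then have "card X1 = n ^ (q + 2)" "card X2 = k ^ (q + 2)"
      unfolding cX1 cX2 using cI by (simp_all add: prod_one_exception)
    moreover have "card X3 = card M - 1" using cX3 True by (simp add: R_def)
    ultimately show ?thesis using cF cM by linarith
  next
    case False
    then have "card X1 = card M * n ^ (q + 1)" "card X2 = (card M - 1) * k ^ (q + 1)"
      unfolding cX1 cX2 using j cI by (simp_all add: prod_one_exception)
    moreover have "card X3 = k" using cX3 False n by (simp add: R_def)
    moreover obtain m where m: "card M = Suc m" using cM by (cases "card M") auto
    moreover obtain d where "k = m + d" using cM m n by (metis Suc_le_mono le_Suc_ex)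
    ultimately show ?thesis using cF star_estimate[of k m d q] n by simp
  qed
qed

text \<open>Every edge contains at least two of the vertices \<open>(a, x)\<close>,
  \<open>(b, y)\<close>, \<open>(c, z)\<close>. Splitting by whether it contains both of the first
  two, or which one it misses, yields three disjoint boxes.\<close>

lemma triangle_case:
  assumes r: "r = q + 3" and n: "n = Suc k" and j: "j < r"
    and abc: "a < r" "b < r" "c < r" "a \<noteq> b" "a \<noteq> c" "b \<noteq> c"
    and M: "M \<subseteq> {1..n}" and F: "F \<subseteq> cube r n" "\<And>A. A \<in> F \<Longrightarrow> A ! j \<in> M"
    and ne: "A1 \<in> F" "A1 ! a = x" "A2 \<in> F" "A2 ! b = y"
    and two: "\<And>A. A \<in> F \<Longrightarrow> A ! a = x \<or> A ! b = y" "\<And>A. A \<in> F \<Longrightarrow> A ! a = x \<or> A ! c = z"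
      "\<And>A. A \<in> F \<Longrightarrow> A ! b = y \<or> A ! c = z"
  shows "card F + k ^ (q + 2) + 1 \<le> n ^ (q + 2) + card M"
proof -
  define R where "R = (\<lambda>l. if l = j then M else {1..n})"
  \<comment> \<open>The update \<open>c := R c\<close> changes nothing; it gives this box the shape
    that \<open>card_box_upd3\<close> counts.\<close>
  define X1 where "X1 = box r (R(a := {x}, b := {y}, c := R c))"
  define X2 where "X2 = box r (R(a := {x}, b := R b - {y}, c := {z}))"
  define X3 where "X3 = box r (R(a := R a - {x}, b := {y}, c := {z}))"
  define P where "P = (\<Prod>l\<in>{..<r} - {a, b, c}. card (R l))"
  have FR: "A ! l \<in> R l" if "A \<in> F" "l < r" for A l
    using F that by (auto simp: R_def cube_def box_def)
  have len: "length A = r" if "A \<in> F" for A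
    using F that by (auto simp: cube_def box_def)
  have finM: "finite M" using M by (rule finite_subset) simp
  have finR: "finite (R l)" for l using finM by (simp add: R_def)
  have cR: "card (R l) = (if l = j then card M else n)" for l by (simp add: R_def)
  have cM: "1 \<le> card M" "card M \<le> n"
    using F(2)[OF ne(1)] finM card_mono[OF _ M] by (auto simp: card_gt_0_iff Suc_le_eq)
  have fin: "finite X1" "finite X2" "finite X3"
    unfolding X1_def X2_def X3_def using finR by (auto intro!: finite_box)
  have "F \<subseteq> X1 \<union> (X2 \<union> X3)"
  proof
    fix A assume A: "A \<in> F"
    consider "A ! a = x" "A ! b = y" | "A ! a = x" "A ! b \<noteq> y" "A ! c = z"
      | "A ! a \<noteq> x" "A ! b = y" "A ! c = z"
      using two[OF A] by blast
    then show "A \<in> X1 \<union> (X2 \<union> X3)"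
    proof cases
      case 1
      then have "A \<in> X1" using A FR len abc by (auto simp: X1_def box_def)
      then show ?thesis by blast
    next
      case 2
      then have "A \<in> X2" using A FR len abc by (auto simp: X2_def box_def)
      then show ?thesis by blast
    next
      case 3
      then have "A \<in> X3" using A FR len abc by (auto simp: X3_def box_def)
      then show ?thesis by blast
    qed
  qed
  then have "card F \<le> card (X1 \<union> (X2 \<union> X3))" using fin by (intro card_mono) auto
  also have "\<dots> \<le> card X1 + (card X2 + card X3)"
    by (rule order_trans[OF card_Un_le add_left_mono[OF card_Un_le]])
  also have "card X1 = card (R c) * P"
    unfolding X1_def P_def by (simp add: card_box_upd3[OF abc])
  also have "card X2 = (card (R b) - 1) * P"
    unfolding X2_def P_def using FR[OF ne(3) abc(2)] ne(4)
    by (simp add: card_box_upd3[OF abc] card_Diff_singleton)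
  also have "card X3 = (card (R a) - 1) * P"
    unfolding X3_def P_def using FR[OF ne(1) abc(1)] ne(2)
    by (simp add: card_box_upd3[OF abc] card_Diff_singleton)
  finally have cF: "card F \<le> (card (R c) + (card (R b) - 1) + (card (R a) - 1)) * P"
    by (simp add: add_mult_distrib)
  have cI: "card ({..<r} - {a, b, c}) = q"
    using abc r by (subst card_Diff_subset) auto
  have P: "P = (if j \<in> {..<r} - {a, b, c} then card M * n ^ (q - 1) else n ^ q)"
  proof -
    have "P = (\<Prod>l\<in>{..<r} - {a, b, c}. if l = j then card M else n)"
      unfolding P_def by (simp add: cR)
    then show ?thesis using cI by (simp add: prod_one_exception)
  qed
  \<comment> \<open>The worst case has \<open>j\<close> among the three parts. Otherwise
    \<open>M\<close> restricts a free coordinate, and \<open>card M \<le> n\<close> leads to the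
    same bound.\<close>
  have main: "card F \<le> (card M + 2 * k) * n ^ q"
  proof (cases "j \<in> {a, b, c}")
    case True
    then have "P = n ^ q" using P by simp
    moreover have "card (R c) + (card (R b) - 1) + (card (R a) - 1) = card M + 2 * k"
      using True abc cM n by (auto simp: R_def)
    ultimately show ?thesis using cF by simp
  next
    case False
    then have jI: "j \<in> {..<r} - {a, b, c}" using j by auto
    then have "q \<noteq> 0" using cI by (metis card_0_eq empty_iff finite_Diff finite_lessThan)
    then obtain q' where q': "q = Suc q'" by (cases q) auto
    have "P = card M * n ^ q'" using P jI q' by simp
    moreover have "card (R c) + (card (R b) - 1) + (card (R a) - 1) = 3 * k + 1"
      using False n by (auto simp: R_def)
    ultimately have "card F \<le> (3 * k + 1) * card M * n ^ q'" using cF by (simp add: algebra_simps)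
    also have "(3 * k + 1) * card M \<le> (card M + 2 * k) * n"
    proof -
      have "2 * k * card M \<le> 2 * k * n" using cM by simp
      moreover have "(3 * k + 1) * card M = 2 * k * card M + n * card M"
        using n by (simp add: algebra_simps)
      moreover have "(card M + 2 * k) * n = n * card M + 2 * k * n" by (simp add: algebra_simps)
      ultimately show ?thesis by linarith
    qed
    finally show ?thesis using q' by (simp add: mult.assoc)
  qed
  show ?thesis using main triangle_estimate[of "card M" k q] cM n by simp
qed

text \<open>The restriction of one part to \<open>M\<close> records that big vertices lying in a common part have been
  removed; for \<open>M = {1..n}\<close> there is no restriction.\<close>

lemma intersecting_family_bound:
  assumes r: "r \<ge> 3" and n: "r * r * r + r * r \<le> n" and j: "j < r"
    and M: "M \<subseteq> {1..n}" and F: "F \<subseteq> cube r n" "\<And>A. A \<in> F \<Longrightarrow> A ! j \<in> M"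
    and inter: "\<And>A B. A \<in> F \<Longrightarrow> B \<in> F \<Longrightarrow> vset A \<inter> vset B \<noteq> {}"
    and nontriv: "\<And>v. \<exists>B\<in>F. v \<notin> vset B"
  shows "card F + (n - 1) ^ (r - 1) + 1 \<le> n ^ (r - 1) + card M"
proof -
  obtain q where q: "r = q + 3" using r by (metis add.commute le_Suc_ex)
  have "n > 0" using n r by (metis add_is_0 gr0I le_zero_eq mult_is_0 not_numeral_le_zero)
  then obtain k where k: "n = Suc k" by (cases n) auto
  obtain A0 where A0: "A0 \<in> F" using nontriv by blast
  obtain Bf where Bf: "\<And>v. Bf v \<in> F" "\<And>v. v \<notin> vset (Bf v)" using nontriv by metis
  have finF: "finite F" using F(1) by (rule finite_subset) simp
  have len: "length A = r" if "A \<in> F" for A using F that by (auto simp: cube_def box_def)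
  have finM: "finite M" using M by (rule finite_subset) simp
  have cM: "1 \<le> card M" using F(2)[OF A0] finM by (auto simp: card_gt_0_iff Suc_le_eq)
  \<comment> \<open>As \<open>q = r - 3\<close>, this bounds the edges through a pair that meet a
    given set of at most \<open>r\<close> vertices off the pair.\<close>
  define K where "K = r * n ^ q"
  define G where "G = (\<lambda>e. {A \<in> F. e \<subseteq> vset A})"
  \<comment> \<open>Each edge meets \<open>A0\<close> in some \<open>v\<close>, and then
    \<open>Bf v\<close> in some \<open>u\<close> other than \<open>v\<close>. Hence it contains one
    of these at most \<open>r * r\<close> pairs.\<close>
  define P where "P = (\<lambda>(v, u). {v, u}) ` (SIGMA v:vset A0. vset (Bf v))"
  define H where "H = {e \<in> P. K < card (G e)}"
  have finP: "finite P" unfolding P_def by auto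
  have cP: "card P \<le> r * r"
  proof -
    have "card P \<le> card (SIGMA v:vset A0. vset (Bf v))"
      unfolding P_def by (rule card_image_le) auto
    also have "\<dots> = r * r" using A0 Bf by (simp add: card_SigmaI card_vset len)
    finally show ?thesis .
  qed
  have P2: "card e = 2" if "e \<in> P" for e
  proof -
    obtain v u where "e = {v, u}" "u \<in> vset (Bf v)" using \<open>e \<in> P\<close> unfolding P_def by auto
    moreover have "u \<noteq> v" using calculation(2) Bf(2) by metis
    ultimately show ?thesis by simp
  qed
  have finH: "finite H" and HP: "H \<subseteq> P" using finP by (auto simp: H_def)
  have finG: "finite (G e)" for e unfolding G_def using finF by simp
  have H_ne: "\<exists>A\<in>F. e \<subseteq> vset A" if "e \<in> H" for e
  proof -
    have "G e \<noteq> {}" using that by (auto simp: H_def)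
    then show ?thesis by (auto simp: G_def)
  qed
  \<comment> \<open>A small set missing \<open>e\<close> but meeting all edges through
    \<open>e\<close> would leave at most \<open>K\<close> of them. This is used first with
    \<open>W\<close> an edge, then, since heavy pairs meet all edges, with \<open>W\<close> another
    heavy pair.\<close>
  have heavy_meets: "e \<inter> W \<noteq> {}"
    if "e \<in> H" "finite W" "card W \<le> r" "\<And>A. A \<in> G e \<Longrightarrow> vset A \<inter> W \<noteq> {}" for e W
  proof
    assume "e \<inter> W = {}"
    have e2: "card e = 2" "finite e" using that(1) HP P2 by (auto simp: card_ge_0_finite)
    have "G e \<subseteq> {B \<in> cube r n. e \<subseteq> vset B \<and> vset B \<inter> W \<noteq> {}}"
      using that(4) F(1) by (auto simp: G_def)
    then have "card (G e) \<le> card {B \<in> cube r n. e \<subseteq> vset B \<and> vset B \<inter> W \<noteq> {}}"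
      by (intro card_mono) auto
    also have "\<dots> \<le> card W * n ^ (r - 1 - card e)"
      using card_edges_meeting_le[of W e r n] that(2) e2(2) \<open>e \<inter> W = {}\<close> by (simp add: Int_commute)
    also have "\<dots> \<le> K" unfolding K_def using that(3) e2 q by simp
    finally show False using that(1) by (simp add: H_def)
  qed
  have heavy_edge: "e \<inter> vset B \<noteq> {}" if "e \<in> H" "B \<in> F" for e B
  proof (rule heavy_meets[OF that(1)])
    show "vset A \<inter> vset B \<noteq> {}" if "A \<in> G e" for A
      using that inter[OF _ \<open>B \<in> F\<close>] by (simp add: G_def)
  qed (simp_all add: card_vset len[OF that(2)])
  have heavy_pair: "e \<inter> f \<noteq> {}" if "e \<in> H" "f \<in> H" for e f
  proof (rule heavy_meets[OF that(1)])
    have "card f = 2" using that HP P2 by auto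
    then show "finite f" "card f \<le> r" using r by (auto simp: card_ge_0_finite)
    show "vset A \<inter> f \<noteq> {}" if "A \<in> G e" for A
      using heavy_edge[OF \<open>f \<in> H\<close>, of A] that by (auto simp: G_def)
  qed
  have "card F + k ^ (q + 2) + 1 \<le> n ^ (q + 2) + card M"
  \<comment> \<open>Here \<open>q + 1 = r - 2\<close>, one less than the number of leaves of a full
    star.\<close>
  proof (cases "card H \<le> q + 1")
    case True
    have "F \<subseteq> (\<Union>e\<in>P. G e)"
    proof
      fix A assume A: "A \<in> F"
      obtain v where v: "v \<in> vset A" "v \<in> vset A0" using inter[OF A A0] by blast
      obtain u where u: "u \<in> vset A" "u \<in> vset (Bf v)" using inter[OF A Bf(1)] by blast
      have "{v, u} \<in> P" using u v by (auto simp: P_def)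
      moreover have "A \<in> G {v, u}" using A u v by (auto simp: G_def)
      ultimately show "A \<in> (\<Union>e\<in>P. G e)" by blast
    qed
    then have "card F \<le> card (\<Union>e\<in>P. G e)" using finP finG by (intro card_mono) auto
    also have "\<dots> \<le> (\<Sum>e\<in>P. card (G e))" by (rule card_UN_le[OF finP])
    also have "\<dots> = (\<Sum>e\<in>P - H. card (G e)) + (\<Sum>e\<in>H. card (G e))"
      by (rule sum.subset_diff[OF HP finP])
    also have "\<dots> \<le> (\<Sum>e\<in>P - H. K) + (\<Sum>e\<in>H. n ^ (q + 1))"
    proof (intro add_mono sum_mono)
      show "card (G e) \<le> K" if "e \<in> P - H" for e using that by (auto simp: H_def)
      show "card (G e) \<le> n ^ (q + 1)" if "e \<in> H" for e
      proof -
        have "card (G e) \<le> card {B \<in> cube r n. e \<subseteq> vset B}"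
          using F(1) by (intro card_mono) (auto simp: G_def)
        also have "\<dots> \<le> n ^ (r - card e)" by (rule card_edges_containing_le)
        finally show ?thesis using P2 HP that q by auto
      qed
    qed
    also have "\<dots> = card (P - H) * K + card H * n ^ (q + 1)" by simp
    also have "\<dots> \<le> r * r * K + (q + 1) * n ^ (q + 1)"
      using True cP card_mono[OF finP, of "P - H"] by (intro add_mono mult_right_mono) auto
    finally have "card F \<le> (q + 1) * n ^ (q + 1) + r * r * r * n ^ q" by (simp add: K_def)
    moreover have "(q + 2) * (q + 1) \<le> r * r" using q by (intro mult_mono) auto
    then have "r * r * r + (q + 2) * (q + 1) \<le> Suc k" using n k by linarith
    from few_heavy_pairs_estimate[OF this] have
      "(q + 1) * n ^ (q + 1) + r * r * r * n ^ q + k ^ (q + 2) \<le> n ^ (q + 2)" using k by simp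
    ultimately show ?thesis using cM by linarith
  next
    case False
    then have "\<not> card H \<le> Suc 0" by simp
    then obtain e f where ef: "e \<in> H" "f \<in> H" "e \<noteq> f"
      using card_le_Suc0_iff_eq[OF finH] by blast
    obtain v where v: "v \<in> e" "v \<in> f" using heavy_pair[OF ef(1,2)] by blast
    have pair: "\<exists>u. u \<noteq> w \<and> g = {w, u}" if "g \<in> H" "w \<in> g" for g w
    proof -
      have "card g = 2" using that HP P2 by blast
      then obtain a b where "g = {a, b}" "a \<noteq> b" unfolding card_2_iff by blast
      then show ?thesis using \<open>w \<in> g\<close> by (metis insert_commute insertE singletonD)
    qed
    obtain p x where px: "v = (p, x)" by (cases v)
    \<comment> \<open>Two-element sets that meet pairwise share a common element or form a
      triangle.\<close>
    show ?thesis
    proof (cases "\<forall>g\<in>H. v \<in> g")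
      case True
      obtain A1 where A1: "A1 \<in> F" "e \<subseteq> vset A1" using H_ne ef by blast
      then have p: "p < r" "A1 ! p = x" using v px len[OF A1(1)] by (auto simp: mem_vset)
      obtain B where B: "B \<in> F" "v \<notin> vset B" using nontriv by blast
      define U where "U = {u. u \<noteq> v \<and> {v, u} \<in> H}"
      have UA: "U \<subseteq> vset A" if "A \<in> F" "v \<notin> vset A" for A
        using heavy_edge[OF _ that(1)] that(2) by (auto simp: U_def)
      have "H \<subseteq> (\<lambda>u. {v, u}) ` U"
      proof
        fix g assume g: "g \<in> H"
        then obtain u where "u \<noteq> v" "g = {v, u}" using pair True by blast
        then show "g \<in> (\<lambda>u. {v, u}) ` U" using g by (auto simp: U_def)
      qed
      moreover have finU: "finite U" using UA[OF B] by (rule finite_subset) simp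
      ultimately have "card H \<le> card U" by (rule surj_card_le[rotated])
      then have cU: "q + 2 \<le> card U" using False by simp
      let ?V = "vset B - {(p, B ! p)}"
      \<comment> \<open>The vertices \<open>v\<close> and \<open>(p, B ! p)\<close> are distinct but
        in the same part, so no edge contains both. Thus at most \<open>r - 1\<close> vertices of
        \<open>B\<close> can be leaves, and the size of \<open>U\<close> makes them all
        leaves.\<close>
      have "(p, B ! p) \<notin> U"
      proof
        assume "(p, B ! p) \<in> U"
        then have u: "(p, B ! p) \<noteq> v" "{v, (p, B ! p)} \<in> H" by (auto simp: U_def)
        then obtain A where "{v, (p, B ! p)} \<subseteq> vset A" using H_ne by blast
        then show False using u(1) px by (auto simp: mem_vset)
      qed
      then have UV: "U \<subseteq> ?V" using UA[OF B] by blast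
      have "(p, B ! p) \<in> vset B" using p len[OF B(1)] by (simp add: mem_vset)
      then have "card ?V = q + 2" using q len[OF B(1)] by (simp add: card_Diff_singleton card_vset)
      then have U: "U = ?V" using UV cU by (intro card_seteq) auto
      show ?thesis
      proof (rule star_case[OF q k j p(1) M F B(1) A1(1) p(2)])
        fix A assume A: "A \<in> F" "A ! p = x"
        obtain l y where "(l, y) \<in> vset A" "(l, y) \<in> vset B" using inter[OF A(1) B(1)] by fastforce
        then show "\<exists>l<r. l \<noteq> p \<and> A ! l = B ! l"
          using B(2) px A len[OF A(1)] by (auto simp: mem_vset)
      next
        fix A l assume A: "A \<in> F" "A ! p \<noteq> x" and l: "l < r" "l \<noteq> p"
        have "(l, B ! l) \<in> U" unfolding U using l len[OF B(1)] by (simp add: mem_vset)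
        moreover have "v \<notin> vset A" using A px by (simp add: mem_vset)
        ultimately have "(l, B ! l) \<in> vset A" using UA[OF A(1)] by blast
        then show "A ! l = B ! l" by (simp add: mem_vset)
      qed
    next
      case nst: False
      then obtain g where g: "g \<in> H" "v \<notin> g" by blast
      obtain a where a: "a \<noteq> v" "e = {v, a}" using pair ef v by blast
      obtain b where b: "b \<noteq> v" "f = {v, b}" using pair ef v by blast
      \<comment> \<open>Since \<open>g\<close> avoids \<open>v\<close>, it can meet \<open>e\<close>
        and \<open>f\<close> only in \<open>a\<close> and \<open>b\<close>.\<close>
      have ab: "a \<noteq> b" "a \<in> g" "b \<in> g"
        using ef a b g heavy_pair[of g e] heavy_pair[of g f] by auto
      then have gab: "g = {a, b}" using pair[OF g(1) ab(2)] by auto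
      obtain p1 x1 where p1: "a = (p1, x1)" by (cases a)
      obtain p2 x2 where p2: "b = (p2, x2)" by (cases b)
      obtain A1 where A1: "A1 \<in> F" "e \<subseteq> vset A1" using H_ne ef by blast
      obtain A2 where A2: "A2 \<in> F" "f \<subseteq> vset A2" using H_ne ef by blast
      obtain A3 where A3: "A3 \<in> F" "g \<subseteq> vset A3" using H_ne g by blast
      note facts = A1 A2 A3 a b gab ab px p1 p2 len[OF A1(1)] len[OF A2(1)] len[OF A3(1)]
      show ?thesis
      proof (rule triangle_case[OF q k j _ _ _ _ _ _ M F A1(1) _ A1(1)])
        show "p < r" "p1 < r" "p2 < r" "p \<noteq> p1" "p \<noteq> p2" "p1 \<noteq> p2" "A1 ! p = x" "A1 ! p1 = x1"
          using facts by (auto simp: mem_vset)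
        fix A assume A: "A \<in> F"
        show "A ! p = x \<or> A ! p1 = x1" "A ! p = x \<or> A ! p2 = x2" "A ! p1 = x1 \<or> A ! p2 = x2"
          using heavy_edge[OF ef(1) A] heavy_edge[OF ef(2) A] heavy_edge[OF g(1) A] facts
          by (auto simp: mem_vset)
      qed
    qed
  qed
  then show ?thesis using q k by simp
qed

section \<open>The upper bound\<close>

lemma is_matching_iff:
  assumes "F \<subseteq> cube r n"
  shows "is_matching F M \<longleftrightarrow> M \<subseteq> F \<and> (\<forall>A\<in>M. \<forall>B\<in>M. A \<noteq> B \<longrightarrow> vset A \<inter> vset B = {})"
proof -
  have "disjoint_edges A B \<longleftrightarrow> vset A \<inter> vset B = {}" if "A \<in> F" "B \<in> F" for A B
    using that assms by (intro disjoint_edges_iff) (auto simp: cube_def box_def)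
  then show ?thesis unfolding is_matching_def by blast
qed

lemma finite_matching_cards: "finite F \<Longrightarrow> finite {card M | M. is_matching F M \<and> finite M}"
  by (rule finite_subset[of _ "card ` Pow F"]) (auto simp: is_matching_def)

lemma matching_number_ge:
  assumes "finite F" "is_matching F M"
  shows "card M \<le> matching_number F"
proof -
  have "finite M" using assms finite_subset unfolding is_matching_def by blast
  then show ?thesis unfolding matching_number_def
    using assms by (intro Max_ge finite_matching_cards) auto
qed

lemma matching_number_le:
  assumes "finite F" "\<And>M. is_matching F M \<Longrightarrow> finite M \<Longrightarrow> card M \<le> s"
  shows "matching_number F \<le> s"
proof -
  have "is_matching F {}" by (simp add: is_matching_def)
  then have "{card M | M. is_matching F M \<and> finite M} \<noteq> {}" by blast
  then show ?thesis unfolding matching_number_def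
    using assms finite_matching_cards by (subst Max_le_iff) auto
qed

lemma vertices_replicate: "vertices (replicate r n) = {..<r} \<times> {1..n}"
  by (auto simp: vertices_def)

lemma vset_subset: "A \<in> cube r n \<Longrightarrow> vset A \<subseteq> {..<r} \<times> {1..n}"
  by (auto simp: cube_def box_def vset_def)

lemma is_transversal_iff:
  "is_transversal (replicate r n) F T \<longleftrightarrow> T \<subseteq> {..<r} \<times> {1..n} \<and> (\<forall>A\<in>F. T \<inter> vset A \<noteq> {})"
  unfolding is_transversal_def vertices_replicate contains_vertex_iff by blast

lemma finite_transversal_cards: "finite {card T | T. is_transversal (replicate r n) F T}"
  by (rule finite_subset[of _ "card ` Pow ({..<r} \<times> {1..n})"]) (auto simp: is_transversal_iff)

lemma transversal_number_le:
  "is_transversal (replicate r n) F T \<Longrightarrow> transversal_number (replicate r n) F \<le> card T"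
  unfolding transversal_number_def by (rule Min_le[OF finite_transversal_cards]) auto

lemma transversal_number_gr:
  assumes "F \<subseteq> cube r n" "0 < r" "\<And>T. is_transversal (replicate r n) F T \<Longrightarrow> s < card T"
  shows "s < transversal_number (replicate r n) F"
proof -
  \<comment> \<open>\<open>Min\<close> of an empty set is unspecified, so some transversal must be
    exhibited. The set of all vertices is one because edges are nonempty.\<close>
  have "vset A \<noteq> {}" if "A \<in> F" for A
    using that assms by (auto simp: cube_def box_def vset_def)
  then have "is_transversal (replicate r n) F ({..<r} \<times> {1..n})"
    using assms(1) vset_subset unfolding is_transversal_iff by blast
  then have "{card T | T. is_transversal (replicate r n) F T} \<noteq> {}" by blast
  then show ?thesis unfolding transversal_number_def
    using assms finite_transversal_cards by (subst Min_gr_iff) auto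
qed

text \<open>Greedy choice: the vertices to be avoided number at most \<open>r * (s + 1)\<close>, so
  the edges through \<open>v\<close> meeting them are fewer than the degree of \<open>v\<close>, and
  some edge through \<open>v\<close> misses them all.\<close>

lemma extend_matching:
  assumes "finite T" and F: "F \<subseteq> cube r n" and r: "r \<ge> 1"
    and "\<And>v. v \<in> T \<Longrightarrow> r * (s + 1) * n ^ (r - 2) < card {A \<in> F. v \<in> vset A}"
    and "is_matching F M" "finite M" "\<And>A. A \<in> M \<Longrightarrow> vset A \<inter> T = {}" "card M + card T \<le> s + 1"
  shows "\<exists>M'. is_matching F M' \<and> card M' = card M + card T"
  using assms(1,4-8)
proof (induction T arbitrary: M rule: finite_induct)
  case empty
  then show ?case by auto
next
  case (insert v T)
  \<comment> \<open>Including \<open>T\<close> keeps the remaining big vertices free for later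
    steps.\<close>
  define W where "W = T \<union> (\<Union>A\<in>M. vset A)"
  have finW: "finite W" using insert by (auto simp: W_def)
  have MF: "M \<subseteq> F" using insert.prems(2) by (simp add: is_matching_def)
  have "card W \<le> card T + card (\<Union>A\<in>M. vset A)" unfolding W_def by (rule card_Un_le)
  also have "card (\<Union>A\<in>M. vset A) \<le> (\<Sum>A\<in>M. card (vset A))"
    by (rule card_UN_le[OF insert.prems(3)])
  also have "(\<Sum>A\<in>M. card (vset A)) = card M * r"
    using MF F by (subst sum.cong[OF refl, of _ _ "\<lambda>_. r"]) (auto simp: card_vset cube_def box_def)
  also have "card T + card M * r \<le> card T * r + card M * r" using r by simp
  also have "\<dots> = r * (card T + card M)" by (simp add: algebra_simps)
  also have "\<dots> \<le> r * (s + 1)" using insert by (intro mult_left_mono) auto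
  finally have cW: "card W \<le> r * (s + 1)" by simp
  have vW: "v \<notin> W" using insert.hyps insert.prems(4) by (auto simp: W_def)
  have "card {B \<in> cube r n. {v} \<subseteq> vset B \<and> vset B \<inter> W \<noteq> {}} \<le> card W * n ^ (r - 1 - card {v})"
    using finW vW by (intro card_edges_meeting_le) auto
  also have "\<dots> \<le> r * (s + 1) * n ^ (r - 1 - card {v})" using cW by (rule mult_right_mono) simp
  also have "r - 1 - card {v} = r - 2" by simp
  also have "r * (s + 1) * n ^ (r - 2) < card {A \<in> F. v \<in> vset A}" using insert.prems(1) by blast
  finally have "\<not> {A \<in> F. v \<in> vset A} \<subseteq> {B \<in> cube r n. {v} \<subseteq> vset B \<and> vset B \<inter> W \<noteq> {}}"
    using card_mono[of "{B \<in> cube r n. {v} \<subseteq> vset B \<and> vset B \<inter> W \<noteq> {}}" "{A \<in> F. v \<in> vset A}"]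
    by fastforce
  then obtain A where A: "A \<in> F" "v \<in> vset A" "vset A \<inter> W = {}" using F by blast
  have AM: "A \<notin> M" using A(2) insert.prems(4)[of A] by blast
  have m: "is_matching F (insert A M)"
    using A insert.prems(2) unfolding is_matching_iff[OF F] W_def by blast
  have "\<exists>M'. is_matching F M' \<and> card M' = card (insert A M) + card T"
  proof (rule insert.IH[OF _ m])
    show "vset B \<inter> T = {}" if "B \<in> insert A M" for B
      using that A(3) insert.prems(4) by (auto simp: W_def)
  qed (use insert AM in auto)
  then show ?case using insert AM by simp
qed

text \<open>The additive form avoids truncated subtraction. In the threshold for \<open>n\<close>,
  the cubic and quadratic terms serve \<open>intersecting_family_bound\<close>, the product pays for
  the edges avoiding fewer than \<open>s - 1\<close> big vertices, and the final \<open>s\<close>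
  gives room for the linear terms.\<close>

lemma upper_bound:
  assumes r: "r \<ge> 3" and s: "s \<ge> 2"
    and n: "r * r * r + r * r + s * r * (r * (s + 1)) + s \<le> n"
    and F: "F \<subseteq> cube r n" and nu: "matching_number F \<le> s"
    and tau: "s < transversal_number (replicate r n) F"
  shows "card F + (n - 1) ^ (r - 1) + s \<le> s * n ^ (r - 1) + n"
proof -
  define V where "V = {..<r} \<times> {1..n}"
  define C where "C = r * (s + 1)"
  define T where "T = {v \<in> V. C * n ^ (r - 2) < card {A \<in> F. v \<in> vset A}}"
  define F' where "F' = {A \<in> F. vset A \<inter> T = {}}"
  define E where "E = (\<lambda>v. {A \<in> cube r n. {v} \<subseteq> vset A})"
  have finF: "finite F" using F by (rule finite_subset) simp
  have finT: "finite T" unfolding T_def V_def by simp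
  have TV: "T \<subseteq> V" by (auto simp: T_def)
  have len: "length A = r" if "A \<in> F" for A using F that by (auto simp: cube_def box_def)
  have ne: "vset A \<noteq> {}" if "A \<in> F" for A using len[OF that] r card_vset[of A] by auto
  have AV: "vset A \<subseteq> V" if "A \<in> F" for A using F that vset_subset unfolding V_def by blast
  have nomatch: "card M \<le> s" if "is_matching F M" for M
    using matching_number_ge[OF finF that] nu by simp
  have notrans: "\<exists>A\<in>F. X \<inter> vset A = {}" if "X \<subseteq> V" "card X \<le> s" for X
    using transversal_number_le[of r n F X] that tau unfolding is_transversal_iff V_def by fastforce
  have big: "r * (s + 1) * n ^ (r - 2) < card {A \<in> F. v \<in> vset A}" if "v \<in> T" for v
    using that by (simp add: T_def C_def)
  \<comment> \<open>A larger matching could be trimmed to \<open>s + 1 - card T\<close> edges and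
    extended through \<open>T\<close> to \<open>s + 1\<close> edges.\<close>
  have matchF': "card M + card T \<le> s" if "is_matching F M" "M \<subseteq> F'" "card T \<le> s" for M
  proof (rule ccontr)
    assume "\<not> card M + card T \<le> s"
    then have "s + 1 - card T \<le> card M" by simp
    then obtain M' where M': "M' \<subseteq> M" "card M' = s + 1 - card T" "finite M'"
      by (rule obtain_subset_with_card_n)
    have "\<exists>M''. is_matching F M'' \<and> card M'' = card M' + card T"
    proof (rule extend_matching[OF finT F _ big])
      show "is_matching F M'" using that(1) M'(1) unfolding is_matching_def by blast
      show "vset A \<inter> T = {}" if "A \<in> M'" for A
        using that M'(1) \<open>M \<subseteq> F'\<close> by (auto simp: F'_def)
    qed (use r M' \<open>card T \<le> s\<close> in auto)
    then show False using nomatch M'(2) \<open>card T \<le> s\<close> by fastforce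
  qed
  \<comment> \<open>Any \<open>s\<close> big vertices fail to be a transversal; an edge avoiding
    them extends to \<open>s + 1\<close> disjoint edges.\<close>
  have cT: "card T < s"
  proof (rule ccontr)
    assume "\<not> card T < s"
    then have "s \<le> card T" by simp
    then obtain T' where T': "T' \<subseteq> T" "card T' = s" "finite T'"
      by (rule obtain_subset_with_card_n)
    then obtain A where A: "A \<in> F" "T' \<inter> vset A = {}" using notrans[of T'] TV by auto
    have "\<exists>M'. is_matching F M' \<and> card M' = card {A} + card T'"
    proof (rule extend_matching[OF T'(3) F _ big])
      show "is_matching F {A}" using A by (simp add: is_matching_def)
      show "vset B \<inter> T' = {}" if "B \<in> {A}" for B using that A by auto
    qed (use r T' in auto)
    then show False using nomatch T'(2) by fastforce
  qed
  have cE: "card (E v) \<le> n ^ (r - 1)" for v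
    using card_edges_containing_le[of r n "{v}"] by (simp add: E_def)
  have finE: "finite (E v)" for v by (simp add: E_def)
  have cUE: "card (\<Union>v\<in>X. E v) \<le> card X * n ^ (r - 1)" if "finite X" for X
  proof -
    have "card (\<Union>v\<in>X. E v) \<le> (\<Sum>v\<in>X. card (E v))" using that by (rule card_UN_le)
    also have "\<dots> \<le> (\<Sum>v\<in>X. n ^ (r - 1))" using cE by (rule sum_mono)
    finally show ?thesis by simp
  qed
  have "F \<subseteq> (\<Union>v\<in>T. E v) \<union> F'" using F by (auto simp: E_def F'_def)
  then have "card F \<le> card ((\<Union>v\<in>T. E v) \<union> F')"
    using finT finE finF by (intro card_mono) (auto simp: F'_def)
  also have "\<dots> \<le> card (\<Union>v\<in>T. E v) + card F'" by (rule card_Un_le)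
  finally have cF: "card F \<le> card (\<Union>v\<in>T. E v) + card F'" .
  show ?thesis
  proof (cases "card T + 2 \<le> s")
    case True
    \<comment> \<open>The vertices of a largest matching in \<open>F'\<close> meet all of
      \<open>F'\<close>. There are at most \<open>s * r\<close> of them and none carries a large
      degree in \<open>F'\<close>.\<close>
    let ?Q = "\<lambda>M. is_matching F M \<and> M \<subseteq> F'"
    have "?Q {}" by (simp add: is_matching_def)
    moreover have "\<forall>M. ?Q M \<longrightarrow> card M < s + 1" using nomatch by fastforce
    ultimately obtain M where M: "?Q M" "\<And>M'. ?Q M' \<Longrightarrow> card M' \<le> card M"
      using ex_has_greatest_nat[of ?Q "{}" card "s + 1"] by blast
    have finM: "finite M" using M(1) finF finite_subset unfolding is_matching_def by blast
    define W where "W = (\<Union>A\<in>M. vset A)"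
    have finW: "finite W" using finM by (simp add: W_def)
    have "card W \<le> (\<Sum>A\<in>M. card (vset A))" unfolding W_def by (rule card_UN_le[OF finM])
    also have "\<dots> = card M * r" using M(1)
      by (subst sum.cong[OF refl, of _ _ "\<lambda>_. r"]) (auto simp: card_vset len F'_def)
    also have "\<dots> \<le> s * r" using nomatch M(1) by simp
    finally have cW: "card W \<le> s * r" .
    have "F' \<subseteq> (\<Union>w\<in>W. {A \<in> F'. w \<in> vset A})"
    proof
      fix A assume A: "A \<in> F'"
      have "vset A \<inter> W \<noteq> {}"
      proof
        assume e: "vset A \<inter> W = {}"
        have AF: "A \<in> F" using A by (simp add: F'_def)
        then have "A \<notin> M" using e ne[OF AF] unfolding W_def by blast
        moreover have "?Q (insert A M)"
          using M(1) A AF e unfolding is_matching_iff[OF F] W_def by blast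
        ultimately show False using M(2)[of "insert A M"] finM by simp
      qed
      then show "A \<in> (\<Union>w\<in>W. {A \<in> F'. w \<in> vset A})" using A by blast
    qed
    then have "card F' \<le> card (\<Union>w\<in>W. {A \<in> F'. w \<in> vset A})"
      using finW finF by (intro card_mono) (auto simp: F'_def)
    also have "\<dots> \<le> (\<Sum>w\<in>W. card {A \<in> F'. w \<in> vset A})" by (rule card_UN_le[OF finW])
    also have "\<dots> \<le> (\<Sum>w\<in>W. C * n ^ (r - 2))"
    proof (rule sum_mono)
      fix w assume "w \<in> W"
      show "card {A \<in> F'. w \<in> vset A} \<le> C * n ^ (r - 2)"
      proof (cases "w \<in> T")
        case True
        then have "{A \<in> F'. w \<in> vset A} = {}" by (auto simp: F'_def)
        then show ?thesis by (simp only: card.empty)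
      next
        case False
        have "w \<in> V" using \<open>w \<in> W\<close> M(1) AV by (auto simp: W_def F'_def)
        then have "card {A \<in> F. w \<in> vset A} \<le> C * n ^ (r - 2)" using False by (auto simp: T_def)
        moreover have "card {A \<in> F'. w \<in> vset A} \<le> card {A \<in> F. w \<in> vset A}"
          using finF by (intro card_mono) (auto simp: F'_def)
        ultimately show ?thesis by simp
      qed
    qed
    also have "\<dots> = card W * C * n ^ (r - 2)" by simp
    also have "\<dots> \<le> s * r * C * n ^ (r - 2)" using cW by (intro mult_right_mono) auto
    also have "\<dots> \<le> n * n ^ (r - 2)" using n unfolding C_def by (intro mult_right_mono) auto
    also have "\<dots> = n ^ Suc (r - 2)" by simp
    also have "Suc (r - 2) = r - 1" using r by simp
    finally have "card F' \<le> n ^ (r - 1)" .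
    moreover have "(n - 1) ^ (r - 1) \<le> n ^ (r - 1)" by (rule power_mono) auto
    moreover have "card (\<Union>v\<in>T. E v) \<le> card T * n ^ (r - 1)" using cUE[OF finT] .
    moreover have "(card T + 2) * n ^ (r - 1) \<le> s * n ^ (r - 1)" using True by (rule mult_right_mono) simp
    then have "card T * n ^ (r - 1) + n ^ (r - 1) + n ^ (r - 1) \<le> s * n ^ (r - 1)"
      by (simp add: algebra_simps)
    ultimately show ?thesis using cF n by linarith
  next
    case False
    then have cT': "card T = s - 1" using cT by simp
    \<comment> \<open>Two disjoint edges avoiding the \<open>s - 1\<close> big vertices would
      contradict \<open>matchF'\<close>.\<close>
    have inter: "vset A \<inter> vset B \<noteq> {}" if "A \<in> F'" "B \<in> F'" for A B
    proof
      assume e: "vset A \<inter> vset B = {}"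
      have AB: "A \<in> F" "B \<in> F" using that by (auto simp: F'_def)
      then have "A \<noteq> B" using e ne by auto
      moreover have "is_matching F {A, B}" using AB e unfolding is_matching_iff[OF F] by blast
      ultimately show False using matchF'[of "{A, B}"] that cT cT' s by auto
    qed
    \<comment> \<open>Adding one vertex to \<open>T\<close> gives at most \<open>s\<close> vertices,
      still not a transversal. A \<open>v\<close> outside the ground set lies in no edge, so
      \<open>T\<close> alone suffices then.\<close>
    have nontriv: "\<exists>B\<in>F'. v \<notin> vset B" for v
    proof (cases "v \<in> V")
      case True
      have "card (insert v T) \<le> s" using cT finT by (simp add: card_insert_if)
      then obtain A where "A \<in> F" "insert v T \<inter> vset A = {}" using notrans[of "insert v T"] True TV by auto
      then show ?thesis by (auto simp: F'_def)
    next
      case False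
      obtain A where "A \<in> F" "T \<inter> vset A = {}" using notrans[of T] TV cT by auto
      then show ?thesis using AV False by (auto simp: F'_def)
    qed
    have F'c: "F' \<subseteq> cube r n" using F by (auto simp: F'_def)
    have F'n: "A ! l \<in> {1..n}" if "A \<in> F'" "l < r" for A l
      using F'c that by (auto simp: cube_def box_def)
    have n3: "r * r * r + r * r \<le> n" using n by simp
    have ss: "s * n ^ (r - 1) = (s - 1) * n ^ (r - 1) + n ^ (r - 1)"
      using s by (cases s) auto
    \<comment> \<open>If two big vertices lie in different parts, the \<open>n\<^bsup>r-2\<^esup>\<close> edges through both are counted twice,
      which outweighs the loss from using the bound with \<open>M = {1..n}\<close>.\<close>
    show ?thesis
    proof (cases "\<exists>j. \<forall>v\<in>T. fst v = j")
      case True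
      then obtain j where j: "\<And>v. v \<in> T \<Longrightarrow> fst v = j" by blast
      have "T \<noteq> {}" using cT' s by auto
      then have jr: "j < r" using j TV by (fastforce simp: V_def)
      have inj: "inj_on snd T" using j by (auto simp: inj_on_def prod_eq_iff)
      \<comment> \<open>Deleting the big vertices from part \<open>j\<close> leaves
        \<open>n - (s - 1)\<close> values, which is where the term \<open>n - s\<close> of the
        formula comes from.\<close>
      define M where "M = {1..n} - snd ` T"
      have "snd ` T \<subseteq> {1..n}" using TV by (auto simp: V_def)
      then have cM: "card M = n - (s - 1)"
        unfolding M_def using finT cT' by (simp add: card_Diff_subset card_image[OF inj])
      have "card F' + (n - 1) ^ (r - 1) + 1 \<le> n ^ (r - 1) + card M"
      proof (rule intersecting_family_bound[OF r n3 jr _ F'c _ inter nontriv])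
        show "M \<subseteq> {1..n}" by (auto simp: M_def)
        fix A assume A: "A \<in> F'"
        have "A ! j \<notin> snd ` T"
        proof
          assume "A ! j \<in> snd ` T"
          then have "(j, A ! j) \<in> T" using j by fastforce
          moreover have "(j, A ! j) \<in> vset A" using jr A len by (auto simp: F'_def mem_vset)
          ultimately show False using A by (auto simp: F'_def)
        qed
        then show "A ! j \<in> M" using F'n[OF A jr] by (simp add: M_def)
      qed
      moreover have "card (\<Union>v\<in>T. E v) \<le> (s - 1) * n ^ (r - 1)" using cUE[OF finT] cT' by simp
      ultimately show ?thesis using cF cM ss n s by linarith
    next
      case False
      then obtain u v where uv: "u \<in> T" "v \<in> T" "fst u \<noteq> fst v" by metis
      have cuv: "card {u, v} = 2" using uv(3) by (metis card_2_iff)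
      have "card {u, v} \<le> card T" using uv finT by (intro card_mono) auto
      then have c2: "2 \<le> s - 1" using cuv cT' by simp
      have uvV: "fst u < r" "fst v < r" "snd u \<in> {1..n}" "snd v \<in> {1..n}"
        using uv TV by (auto simp: V_def)
      \<comment> \<open>An edge through both \<open>u\<close> and \<open>v\<close> exists because
        they lie in different parts; the filler value 1 is in range.\<close>
      define A where "A = (replicate r 1)[fst u := snd u, fst v := snd v]"
      have "A \<in> cube r n" using uvV by (auto simp: A_def cube_def box_def nth_list_update)
      moreover have "{u, v} \<subseteq> vset A"
        using uv uvV by (cases u; cases v) (auto simp: A_def mem_vset nth_list_update)
      ultimately have "card {B \<in> cube r n. {u, v} \<subseteq> vset B} = n ^ (r - card {u, v})"
        by (rule card_edges_containing)
      moreover note cuv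
      moreover have "{B \<in> cube r n. {u, v} \<subseteq> vset B} = E u \<inter> E v" by (auto simp: E_def)
      ultimately have "card (E u \<inter> E v) = n ^ (r - 2)" by simp
      then have 1: "card (E u \<union> E v) + n ^ (r - 2) \<le> 2 * n ^ (r - 1)"
        using card_Un_Int[OF finE finE, of u v] cE[of u] cE[of v] by simp
      have "(\<Union>v\<in>T. E v) = (E u \<union> E v) \<union> (\<Union>w\<in>T - {u, v}. E w)" using uv by blast
      then have "card (\<Union>v\<in>T. E v) \<le> card (E u \<union> E v) + card (\<Union>w\<in>T - {u, v}. E w)"
        by (simp only: card_Un_le)
      also have "card (\<Union>w\<in>T - {u, v}. E w) \<le> card (T - {u, v}) * n ^ (r - 1)"
        using finT by (intro cUE) auto
      also have "card (T - {u, v}) = s - 1 - 2"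
        using uv cT' cuv by (subst card_Diff_subset) auto
      finally have "card (\<Union>v\<in>T. E v) + n ^ (r - 2) \<le> (s - 1 - 2) * n ^ (r - 1) + 2 * n ^ (r - 1)"
        using 1 by linarith
      also have "\<dots> = (s - 1 - 2 + 2) * n ^ (r - 1)" by (simp only: add_mult_distrib)
      also have "s - 1 - 2 + 2 = s - 1" using c2 by simp
      finally have 2: "card (\<Union>v\<in>T. E v) + n ^ (r - 2) \<le> (s - 1) * n ^ (r - 1)" .
      have "card F' + (n - 1) ^ (r - 1) + 1 \<le> n ^ (r - 1) + card {1..n}"
        using r F'n by (intro intersecting_family_bound[OF r n3 _ _ F'c _ inter nontriv, of 0]) auto
      \<comment> \<open>The doubly counted edges number at least \<open>n\<close>, hence at least
        \<open>s\<close>, enough to replace the unrestricted bound.\<close>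
      moreover have "n ^ 1 \<le> n ^ (r - 2)" using r n s by (intro power_increasing) auto
      ultimately show ?thesis using cF 2 ss n by simp
    qed
  qed
qed

section \<open>The extremal family\<close>

text \<open>Coordinates start at 1, so the first clause is the union of the stars at
  \<open>(0, 1)\<close>, ..., \<open>(0, s - 1)\<close>. The other two form a Hilton-Milner family
  with centre \<open>(0, s)\<close>, whose edges off the centre are all ones after the first
  coordinate.\<close>

definition extremal_family :: "nat \<Rightarrow> nat \<Rightarrow> nat \<Rightarrow> nat list set" where
  "extremal_family r s n = {A \<in> cube r n. A ! 0 < s \<or>
     A ! 0 = s \<and> (\<exists>l. 0 < l \<and> l < r \<and> A ! l = 1) \<or>
     A ! 0 > s \<and> (\<forall>l. 0 < l \<and> l < r \<longrightarrow> A ! l = 1)}"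

lemma card_extremal_family:
  assumes "r \<ge> 1" "1 \<le> s" "s \<le> n"
  shows "card (extremal_family r s n) + (n - 1) ^ (r - 1) + s = s * n ^ (r - 1) + n"
proof -
  define X1 where "X1 = box r ((\<lambda>_. {1..n})(0 := {1..s - 1}))"
  define X2 where "X2 = box r ((\<lambda>_. {1..n})(0 := {s}))"
  define X3 where "X3 = box r ((\<lambda>_. {1..n} - {1})(0 := {s}))"
  define X4 where "X4 = box r ((\<lambda>_. {1})(0 := {s + 1..n}))"
  have r: "0 < r" using assms by simp
  have cI: "card ({..<r} - {0}) = r - 1" using r by (simp add: card_Diff_singleton)
  have c1: "card X1 = (s - 1) * n ^ (r - 1)" unfolding X1_def card_box_upd1[OF r] using cI by simp
  have c2: "card X2 = n ^ (r - 1)" unfolding X2_def card_box_upd1[OF r] using cI by simp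
  have "card ({1..n} - {1}) = n - 1" using assms by simp
  then have c3: "card X3 = (n - 1) ^ (r - 1)" unfolding X3_def card_box_upd1[OF r] using cI by simp
  have c4: "card X4 = n - s" unfolding X4_def card_box_upd1[OF r] using cI by simp
  have upd0: "A \<in> box r (Y(0 := Z)) \<longleftrightarrow>
      length A = r \<and> A ! 0 \<in> Z \<and> (\<forall>l. 0 < l \<and> l < r \<longrightarrow> A ! l \<in> Y l)" for A Y Z
    using r unfolding box_def by (auto simp: fun_upd_def)
  have cube: "A \<in> cube r n \<longleftrightarrow>
      length A = r \<and> A ! 0 \<in> {1..n} \<and> (\<forall>l. 0 < l \<and> l < r \<longrightarrow> A ! l \<in> {1..n})" for A
    using upd0[of A "\<lambda>_. {1..n}" "{1..n}"] by (simp add: cube_def fun_upd_idem)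
  have m1: "A \<in> X1 \<longleftrightarrow> A \<in> cube r n \<and> A ! 0 < s" for A
    using assms unfolding X1_def upd0 cube by auto
  have m2: "A \<in> X2 \<longleftrightarrow> A \<in> cube r n \<and> A ! 0 = s" for A
    using assms unfolding X2_def upd0 cube by auto
  have m3: "A \<in> X3 \<longleftrightarrow> A \<in> cube r n \<and> A ! 0 = s \<and> (\<forall>l. 0 < l \<and> l < r \<longrightarrow> A ! l \<noteq> 1)" for A
    using assms unfolding X3_def upd0 cube by auto
  have m4: "A \<in> X4 \<longleftrightarrow> A \<in> cube r n \<and> A ! 0 > s \<and> (\<forall>l. 0 < l \<and> l < r \<longrightarrow> A ! l = 1)" for A
    using assms unfolding X4_def upd0 cube by auto
  have fin: "finite X1" "finite X2" "finite X4"
    using m1 m2 m4 by (auto intro: finite_subset[OF _ finite_cube[of r n]])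
  have X32: "X3 \<subseteq> X2" using m2 m3 by blast
  have "extremal_family r s n = X1 \<union> ((X2 - X3) \<union> X4)"
    unfolding extremal_family_def set_eq_iff Un_iff Diff_iff m1 m2 m3 m4 mem_Collect_eq by blast
  also have "card \<dots> = card X1 + card ((X2 - X3) \<union> X4)"
    using fin m1 m2 m4 by (intro card_Un_disjoint) auto
  also have "card ((X2 - X3) \<union> X4) = card (X2 - X3) + card X4"
    using fin m2 m4 by (intro card_Un_disjoint) auto
  also have "card (X2 - X3) = card X2 - card X3"
    using X32 fin by (metis card_Diff_subset finite_subset)
  finally have "card (extremal_family r s n) = (s - 1) * n ^ (r - 1) + (n ^ (r - 1) - (n - 1) ^ (r - 1) + (n - s))"
    using c1 c2 c3 c4 by simp
  moreover have "(n - 1) ^ (r - 1) \<le> n ^ (r - 1)" by (rule power_mono) auto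
  moreover have "s * n ^ (r - 1) = (s - 1) * n ^ (r - 1) + n ^ (r - 1)"
    using assms by (cases s) auto
  ultimately show ?thesis using assms by linarith
qed

text \<open>Capping the first coordinate at \<open>s\<close> is injective on a matching: two edges
  with first coordinate at least \<open>s\<close> agree there if both have value \<open>s\<close>,
  and otherwise share a later coordinate 1.\<close>

lemma extremal_family_matching_number:
  assumes "r \<ge> 2" "s \<ge> 1"
  shows "matching_number (extremal_family r s n) \<le> s"
proof (rule matching_number_le)
  let ?F = "extremal_family r s n"
  have F: "?F \<subseteq> cube r n" by (auto simp: extremal_family_def)
  then show "finite ?F" by (rule finite_subset) simp
  fix M assume M: "is_matching ?F M" "finite M"
  have ne: "A ! l \<noteq> B ! l" if "A \<in> M" "B \<in> M" "A \<noteq> B" "l < r" for A B l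
  proof -
    have "disjoint_edges A B" "A \<in> cube r n" using M(1) that F unfolding is_matching_def by blast+
    then show ?thesis using that by (simp add: disjoint_edges_def cube_def box_def)
  qed
  have asym: False if AB: "A \<in> M" "B \<in> M" "A \<noteq> B" and gt: "A ! 0 > s" "B ! 0 \<ge> s" for A B
  proof -
    have A: "A ! l = 1" if "0 < l" "l < r" for l
      using M(1) AB gt that by (auto simp: is_matching_def extremal_family_def)
    obtain l where "0 < l" "l < r" "B ! l = 1"
    proof (cases "B ! 0 = s")
      case True
      then show ?thesis using that M(1) AB by (auto simp: is_matching_def extremal_family_def)
    next
      case False
      then show ?thesis using that[of 1] M(1) AB gt assms
        by (auto simp: is_matching_def extremal_family_def)
    qed
    then show False using A ne[OF AB] by metis
  qed
  have "inj_on (\<lambda>A. min (A ! 0) s) M"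
  proof (rule inj_onI, rule ccontr)
    fix A B assume AB: "A \<in> M" "B \<in> M" "min (A ! 0) s = min (B ! 0) s" "A \<noteq> B"
    then have "A ! 0 \<noteq> B ! 0" using ne[OF AB(1,2,4), of 0] assms by simp
    then have "A ! 0 \<ge> s" "B ! 0 \<ge> s" "A ! 0 > s \<or> B ! 0 > s"
      using AB(3) by (auto simp: min_def split: if_splits)
    then show False using asym AB by metis
  qed
  moreover have "(\<lambda>A. min (A ! 0) s) ` M \<subseteq> {1..s}"
    using M(1) F assms by (force simp: is_matching_def cube_def box_def)
  ultimately have "card M \<le> card {1..s}" by (rule card_inj_on_le) simp
  then show "card M \<le> s" by simp
qed

text \<open>With at most \<open>s < n\<close> vertices, a transversal fills no part. It must then
  contain all \<open>s - 1\<close> star centres, and the Hilton-Milner edges force two more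
  vertices.\<close>

lemma extremal_family_transversal_number:
  assumes r: "r \<ge> 3" and s: "s \<ge> 1" "s < n"
  shows "s < transversal_number (replicate r n) (extremal_family r s n)"
proof (rule transversal_number_gr)
  let ?F = "extremal_family r s n"
  show F: "?F \<subseteq> cube r n" by (auto simp: extremal_family_def)
  show "0 < r" using r by simp
  fix T assume T: "is_transversal (replicate r n) ?F T"
  have TV: "T \<subseteq> {..<r} \<times> {1..n}" using T by (simp add: is_transversal_iff)
  have finT: "finite T" using TV by (rule finite_subset) simp
  have edge_hit: "\<exists>l<r. (l, f l) \<in> T" if "map f [0..<r] \<in> ?F" for f
  proof -
    obtain l x where "(l, x) \<in> T" "(l, x) \<in> vset (map f [0..<r])"
      using T \<open>map f [0..<r] \<in> ?F\<close> unfolding is_transversal_iff by fast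
    then show ?thesis by (auto simp: mem_vset)
  qed
  show "s < card T"
  proof (rule ccontr)
    assume "\<not> s < card T"
    have "\<exists>y\<in>{1..n}. (l, y) \<notin> T" for l
    proof (rule ccontr)
      assume "\<not> (\<exists>y\<in>{1..n}. (l, y) \<notin> T)"
      then have "Pair l ` {1..n} \<subseteq> T" by auto
      then have "card (Pair l ` {1..n}) \<le> card T" using finT by (rule card_mono[rotated])
      then show False using \<open>\<not> s < card T\<close> s by (simp add: card_image inj_on_def)
    qed
    \<comment> \<open>The edge \<open>(i, y 1, ..., y (r - 1))\<close> with \<open>i < s\<close> can
      be hit only at \<open>(0, i)\<close>.\<close>
    then obtain y where y: "\<And>l. y l \<in> {1..n}" "\<And>l. (l, y l) \<notin> T" by metis
    define S where "S = Pair (0::nat) ` {1..<s}"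
    have ST: "S \<subseteq> T"
    proof
      fix v assume "v \<in> S"
      then obtain i where i: "v = (0, i)" "1 \<le> i" "i < s" by (auto simp: S_def)
      let ?f = "\<lambda>l. if l = 0 then i else y l"
      have "map ?f [0..<r] \<in> ?F"
        using i y s r by (auto simp: extremal_family_def cube_def box_def)
      then show "v \<in> T" using edge_hit[of ?f] y(2) i by (auto split: if_splits)
    qed
    let ?g = "\<lambda>l. if l = 0 then s else 1"
    have "map ?g [0..<r] \<in> ?F"
      using s r by (auto simp: extremal_family_def cube_def box_def intro!: exI[of _ 1])
    then obtain l where l: "l < r" "(l, ?g l) \<in> T" using edge_hit by blast
    have wS: "(l, ?g l) \<notin> S" by (auto simp: S_def)
    \<comment> \<open>If \<open>(0, s)\<close> was hit, the edge starting with \<open>Suc s\<close>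
      avoids it. If a later coordinate \<open>l\<close> was hit, changing it to 2 avoids that vertex
      and stays in the family, since \<open>r \<ge> 3\<close> leaves another coordinate equal to
      1.\<close>
    obtain w where w: "w \<in> T" "w \<notin> S" "w \<noteq> (l, ?g l)"
    proof (cases "l = 0")
      case True
      let ?h = "\<lambda>l. if l = 0 then Suc s else 1"
      have "map ?h [0..<r] \<in> ?F"
        using s r by (auto simp: extremal_family_def cube_def box_def)
      then obtain l' where l': "(l', ?h l') \<in> T" using edge_hit by blast
      show ?thesis by (rule that[OF l']) (use True in \<open>auto simp: S_def split: if_splits\<close>)
    next
      case False
      let ?h = "?g(l := 2)"
      have "\<exists>l'. 0 < l' \<and> l' < r \<and> l' \<noteq> l"
        using r by (intro exI[of _ "if l = 1 then 2 else 1"]) auto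
      then have "map ?h [0..<r] \<in> ?F"
        using s r False by (auto simp: extremal_family_def cube_def box_def)
      then obtain l' where l': "(l', ?h l') \<in> T" using edge_hit by blast
      show ?thesis by (rule that[OF l']) (use False in \<open>auto simp: S_def split: if_splits\<close>)
    qed
    have "finite S" "card S = s - 1" by (auto simp: S_def card_image inj_on_def)
    then have "card (insert w (insert (l, ?g l) S)) = s + 1"
      using wS w s by simp
    moreover have "card (insert w (insert (l, ?g l) S)) \<le> card T"
      using finT w l ST by (intro card_mono) auto
    ultimately show False using \<open>\<not> s < card T\<close> by simp
  qed
qed

theorem theorem1p2:
  fixes r s :: nat
  assumes "r \<ge> 3" and "s \<ge> 2"
  shows "\<exists>N::nat. \<forall>n::nat. n > N \<longrightarrow>
           int (m0 s (replicate r n)) =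
             int s * int n ^ (r - 1) - (int n - 1) ^ (r - 1) + int n - int s"
proof (intro exI allI impI)
  fix n :: nat
  assume n: "n > r * r * r + r * r + s * r * (r * (s + 1)) + s"
  let ?F0 = "extremal_family r s n"
  let ?P = "\<lambda>F. F \<subseteq> edges (replicate r n) \<and> matching_number F \<le> s
    \<and> s < transversal_number (replicate r n) F"
  have card0: "card ?F0 + (n - 1) ^ (r - 1) + s = s * n ^ (r - 1) + n"
    using assms n by (intro card_extremal_family) auto
  have P0: "?P ?F0"
    using assms n extremal_family_matching_number[of r s n] extremal_family_transversal_number[of r s n]
    by (auto simp: edges_replicate extremal_family_def)
  have "m0 s (replicate r n) = card ?F0" unfolding m0_def
  proof (rule Max_eqI)
    show "finite {card F | F. ?P F}"
      by (rule finite_subset[of _ "card ` Pow (cube r n)"]) (auto simp: edges_replicate)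
    show "card ?F0 \<in> {card F | F. ?P F}" using P0 by blast
    fix c assume "c \<in> {card F | F. ?P F}"
    then obtain F where F: "c = card F" "?P F" by blast
    then have "card F + (n - 1) ^ (r - 1) + s \<le> s * n ^ (r - 1) + n"
      using assms n by (intro upper_bound) (auto simp: edges_replicate)
    then show "c \<le> card ?F0" using card0 F by linarith
  qed
  \<comment> \<open>The additive identity transfers to integers without truncated
    subtraction.\<close>
  moreover have "int (card ?F0) + int (n - 1) ^ (r - 1) + int s = int s * int n ^ (r - 1) + int n"
    using arg_cong[OF card0, of int] by simp
  moreover have "int (n - 1) = int n - 1" using n by simp
  ultimately show "int (m0 s (replicate r n)) =
      int s * int n ^ (r - 1) - (int n - 1) ^ (r - 1) + int n - int s"
    by simp
qed

end
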